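(* Let $y\in\Gamma_S(\mathcal{V}_0,Y)$ be a regular critical section (with fixed boundary) of the Lagrange problem given by $(\mathcal{L},\Phi)$, let $\lambda\in\mathrm{Map}(\mathcal{V},\mathfrak{g}^* )$ be the multiplier associated to $y$, and let $D\in\mathfrak{X}(Y)$ be an infinitesimal symmetry of the Lagrange problem. Then $$\sum_{\substack{v\in\operatorname{fr}\mathcal{V},\ \alpha\in\mathcal{V}\\ v\prec\alpha}}\Big[\big(\Theta_\alpha^v(\mathcal{L})+\lambda(\alpha)\circ\Theta_\alpha^v(\Phi)\big)\big((j^1D)_\alpha\big)\Big]\big((j^1y)(\alpha)\big)=0 .$$
   Context: **Complex.** $V$ is an $n$-dimensional abstract cellular complex, $V_k$ its set of $k$-dimensional cells; elements of $V_0$ are vertices, elements of $V_n$ are faces. There is an incidence relation between $k$-cells and $(k+1)$-cells; a cell $\alpha$ is adherent to a cell $\beta$, written $\alpha\prec\beta$, if $\alpha=\beta$ or there is a chain of cells of consecutive dimensions from $\alpha$ to $\beta$, each incident to the next. Each face has finitely many adherent vertices. For $v\in V_0$, $S_v=\{\alpha\in V_n: v\prec\alpha\}$. $\mathcal{V}\subset V_n$ is a finite set of faces and $\mathcal{V}_0=\{v\in V_0: v\prec\alpha \text{ for some }\alpha\in\mathcal{V}\}$. A vertex $v\in\mathcal{V}_0$ is interior ($v\in\operatorname{int}\mathcal{V}$) if $S_v\subset\mathcal{V}$, and frontier ($v\in\operatorname{fr}\mathcal{V}$) otherwise. **Bundles.** $\pi:Y\to V_0$ is a bundle whose fibers $Y_v$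 are differentiable manifolds of the same dimension $m$. $J^1Y=\bigsqcup_{\alpha\in V_n}(J^1Y)_\alpha$ with $(J^1Y)_\alpha=\prod_{v\prec\alpha}Y_v$. $(J^2Y)_v=\prod_{v'}Y_{v'}$, the product over all vertices $v'$ adherent to some face of $S_v$. For $\alpha\in S_v$, $\pi_{v\alpha}:(J^2Y)_v\to(J^1Y)_\alpha$ is the canonical projection. $\Gamma(\mathcal{V}_0,Y)=\prod_{v\in\mathcal{V}_0}Y_v$. For a section $y$, $(j^1y)(\alpha)=(y(v))_{v\prec\alpha}$ and $(j^2y)(v)=(y(v'))_{v'\prec\alpha\in S_v}$; for $\delta y\in T_y\Gamma(\mathcal{V}_0,Y)=\bigoplus_{v\in\mathcal V_0} T_{y(v)}Y_v$, $(j^1\delta y)(\alpha)=(\delta y(v))_{v\prec\alpha}$. **Lagrangian and constraint.** $\mathcal{L}:J^1Y\to\mathbb{R}$ is a family of smooth functions $\mathcal{L}_\alpha:(J^1Y)_\alpha\to\mathbb{R}$. $G$ is a Lie group with identity $e$, Lie algebra $\mathfrak{g}=T_eG$, and Maurer–Cartan form $\theta_g(D_g)=(L_{g^{-1}})_*D_g\in\mathfrak{g}$. $\Phi:J^1Y\to G$ is a map whose restrictions $\Phi_\alpha=\Phi|_{(J^1Y)_\alpha}$ are differentiable with $e$ a regular value; $S_\alpha=\Phi_\alpha^{-1}(e)$, $S=\bigsqcup_\alpha S_\alpha=\Phi^{-1}(e)$. **Admissibility, criticality, regularity.** $y\in\Gamma(\mathcal{V}_0,Y)$ is admissible, $y\in\Gamma_S(\mathcal{V}_0,Y)$,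 if $(j^1y)(\alpha)\in S_\alpha$ for all $\alpha\in\mathcal{V}$. For $y$ admissible, $\delta y$ is admissible if $(d\Phi_\alpha)_{(j^1y)(\alpha)}(j^1\delta y)(\alpha)=0$ for all $\alpha\in\mathcal{V}$. An admissible $y$ is critical (with fixed boundary) if the differential at $y$ of $\mathcal{A}_{\mathcal{V}}(\mathcal{L}):y\mapsto\sum_{\alpha\in\mathcal{V}}\mathcal{L}((j^1y)(\alpha))$ vanishes on all admissible $\delta y$ that vanish at every $v\in\operatorname{fr}\mathcal{V}$. An admissible $y$ is regular if the linear map from $\{\delta y\in T_y\Gamma(\mathcal{V}_0,Y):\delta y(v)=0\ \forall v\in\operatorname{fr}\mathcal{V}\}$ to $\mathrm{Map}(\mathcal{V},\mathfrak{g})$, $\delta y\mapsto\big(\alpha\mapsto(\theta\circ d\Phi_\alpha)_{(j^1y)(\alpha)}((j^1\delta y)(\alpha))\big)$, is onto. **Cartan forms and multiplier.** For $v\prec\alpha$, $\Theta_\alpha^v(\Phi)$ is the $\mathfrak{g}$-valued 1-form on $(J^1Y)_\alpha$ that is the component along $Y_v$ of $\theta\circ d\Phi_\alpha$: it sends $X=(X_{v'})_{v'\prec\alpha}$ to $(\theta\circ d\Phi_\alpha)$ applied to the vector with $v$-component $X_v$ and all other components $0$. Likewise $\Theta^v_\alpha(\mathcal{L})$ is the component along $Y_v$ of $d\mathcal{L}_\alpha$, and $\mathcal{E}_v(\mathcal{L})=\sum_{\alpha\in S_v}\pi_{v\alpha}^*\Theta_\alpha^v(\mathcal{L})$ on $(J^2Y)_v$.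 The symbol $\circ$ between an element of $\mathfrak{g}^*$ and a $\mathfrak{g}$-valued form is the duality pairing. The multiplier associated to a regular critical section $y$ is the unique $\lambda\in\mathrm{Map}(\mathcal{V},\mathfrak{g}^* )$ with $\big(\mathcal{E}_v(\mathcal{L})+\sum_{\alpha\in S_v}\pi_{v\alpha}^*(\lambda(\alpha)\circ\Theta_\alpha^v(\Phi))\big)_{(j^2y)(v)}=0$ for all $v\in\operatorname{int}\mathcal{V}$ (it exists and is unique for such $y$). **Symmetries.** A vector field $D\in\mathfrak{X}(Y)$ is a family of vector fields $D_v\in\mathfrak{X}(Y_v)$, $v\in V_0$; its 1-jet extension $j^1D$ is the vector field on $J^1Y$ with $\big((j^1D)_\alpha\big)_{(y_v)_{v\prec\alpha}}=\big((D_v)_{y_v}\big)_{v\prec\alpha}$. $D$ is an infinitesimal symmetry of the Lagrange problem if $(j^1D)\mathcal{L}=0$ and $(d\Phi)(j^1D)=0$, i.e. $(d\Phi)_{j^1_\alpha y}(j^1D)_{j^1_\alpha y}=0\in T_{\Phi(j^1_\alpha y)}G$ at every point $j^1_\alpha y\in J^1Y$. *)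

theory Defs
  imports "HOL-Analysis.Analysis" "HOL-Algebra.Group"
begin

section \<open>Calculus in finite-dimensional coordinate spaces\<close>

text \<open>
  The space of real families indexed by a finite set \<open>I\<close>.  The dimensions of the spaces
  \<open>(J\<^sup>1Y)\<^sub>\<alpha>\<close> vary with \<open>\<alpha>\<close>, so the dimension cannot be carried by a type.  As in
  \<^const>\<open>Euclidean_space\<close> (which is the case \<open>I = {..<n}\<close>), coordinates outside \<open>I\<close> are \<open>0\<close>.
\<close>

definition coord_space :: "'i set \<Rightarrow> ('i \<Rightarrow> real) topology" where
  "coord_space I = subtopology (powertop_real UNIV) {x. \<forall>i. i \<notin> I \<longrightarrow> x i = 0}"

definition partial_deriv :: "'i \<Rightarrow> (('i \<Rightarrow> real) \<Rightarrow> real) \<Rightarrow> ('i \<Rightarrow> real) \<Rightarrow> real" where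
  "partial_deriv i f x = deriv (\<lambda>t. f (x(i := t))) (x i)"

text \<open>
  In the next two definitions \<open>U\<close> is meant to be open in the coordinate space.
\<close>

primrec cont_diff_on ::
    "'i set \<Rightarrow> nat \<Rightarrow> ('i \<Rightarrow> real) set \<Rightarrow> (('i \<Rightarrow> real) \<Rightarrow> real) \<Rightarrow> bool" where
  "cont_diff_on I 0 U f =
     continuous_map (subtopology (coord_space I) U) euclideanreal f"
| "cont_diff_on I (Suc k) U f =
     (continuous_map (subtopology (coord_space I) U) euclideanreal f \<and>
      (\<forall>i\<in>I. (\<forall>x\<in>U. (\<lambda>t. f (x(i := t))) field_differentiable (at (x i))) \<and>
             cont_diff_on I k U (partial_deriv i f)))"

definition smooth_on :: "'i set \<Rightarrow> ('i \<Rightarrow> real) set \<Rightarrow> (('i \<Rightarrow> real) \<Rightarrow> real) \<Rightarrow> bool" where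
  "smooth_on I U f \<longleftrightarrow> (\<forall>k. cont_diff_on I k U f)"

text \<open>Frechet differentiability at a point, with respect to the Euclidean norm.\<close>

definition total_differentiable_at ::
    "'i set \<Rightarrow> (('i \<Rightarrow> real) \<Rightarrow> real) \<Rightarrow> ('i \<Rightarrow> real) \<Rightarrow> bool" where
  "total_differentiable_at I f x \<longleftrightarrow>
     (\<exists>a. \<forall>\<epsilon>>0. \<exists>\<delta>>0. \<forall>z\<in>topspace (coord_space I).
        L2_set (\<lambda>i. z i - x i) I < \<delta> \<longrightarrow>
        \<bar>f z - f x - (\<Sum>i\<in>I. a i * (z i - x i))\<bar> \<le> \<epsilon> * L2_set (\<lambda>i. z i - x i) I)"


section \<open>Smooth manifolds\<close>

text \<open>
  A space with an atlas, presented as a family of charts indexed by \<open>charts\<close>; \<open>coords\<close> is the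
  index set of the coordinates, so its cardinality is the dimension.  The atlas need not be
  maximal.
\<close>

record ('a, 'k, 'i) manifold =
  mtop :: "'a topology"
  coords :: "'i set"
  charts :: "'k set"
  cdom :: "'k \<Rightarrow> 'a set"
  cmap :: "'k \<Rightarrow> 'a \<Rightarrow> 'i \<Rightarrow> real"

abbreviation points :: "('a, 'k, 'i) manifold \<Rightarrow> 'a set" where
  "points M \<equiv> topspace (mtop M)"

definition cinv :: "('a, 'k, 'i) manifold \<Rightarrow> 'k \<Rightarrow> ('i \<Rightarrow> real) \<Rightarrow> 'a" where
  "cinv M a = inv_into (cdom M a) (cmap M a)"

definition charts_at :: "('a, 'k, 'i) manifold \<Rightarrow> 'a \<Rightarrow> 'k set" where
  "charts_at M p = {a \<in> charts M. p \<in> cdom M a}"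

definition smooth_manifold :: "('a, 'k, 'i) manifold \<Rightarrow> bool" where
  "smooth_manifold M \<longleftrightarrow>
     finite (coords M) \<and> Hausdorff_space (mtop M) \<and> second_countable (mtop M) \<and>
     (\<Union>a\<in>charts M. cdom M a) = points M \<and>
     (\<forall>a\<in>charts M. openin (mtop M) (cdom M a) \<and>
        openin (coord_space (coords M)) (cmap M a ` cdom M a) \<and>
        homeomorphic_map (subtopology (mtop M) (cdom M a))
          (subtopology (coord_space (coords M)) (cmap M a ` cdom M a)) (cmap M a)) \<and>
     (\<forall>a\<in>charts M. \<forall>b\<in>charts M. \<forall>j\<in>coords M.
        smooth_on (coords M) (cmap M a ` (cdom M a \<inter> cdom M b))
          (\<lambda>x. cmap M b (cinv M a x) j))"

definition smooth_function :: "('a, 'k, 'i) manifold \<Rightarrow> ('a \<Rightarrow> real) \<Rightarrow> bool" where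
  "smooth_function M f \<longleftrightarrow>
     (\<forall>a\<in>charts M. smooth_on (coords M) (cmap M a ` cdom M a) (\<lambda>x. f (cinv M a x)))"

definition smooth_map ::
    "('a, 'k, 'i) manifold \<Rightarrow> ('b, 'l, 'j) manifold \<Rightarrow> ('a \<Rightarrow> 'b) \<Rightarrow> bool" where
  "smooth_map M N F \<longleftrightarrow>
     continuous_map (mtop M) (mtop N) F \<and>
     (\<forall>a\<in>charts M. \<forall>b\<in>charts N. \<forall>j\<in>coords N.
        smooth_on (coords M) (cmap M a ` {p \<in> cdom M a. F p \<in> cdom N b})
          (\<lambda>x. cmap N b (F (cinv M a x)) j))"

definition differentiable_map ::
    "('a, 'k, 'i) manifold \<Rightarrow> ('b, 'l, 'j) manifold \<Rightarrow> ('a \<Rightarrow> 'b) \<Rightarrow> bool" where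
  "differentiable_map M N F \<longleftrightarrow>
     continuous_map (mtop M) (mtop N) F \<and>
     (\<forall>p\<in>points M. \<forall>a\<in>charts_at M p. \<forall>b\<in>charts_at N (F p). \<forall>j\<in>coords N.
        total_differentiable_at (coords M) (\<lambda>x. cmap N b (F (cinv M a x)) j) (cmap M a p))"

text \<open>
  A tangent vector at \<open>p\<close> is the family of its coordinate vectors in all the charts around \<open>p\<close>,
  related to each other by the Jacobian matrices of the chart transitions.  Entries that carry no
  information are \<open>0\<close>, so that the vector space operations are the pointwise ones.
\<close>

type_synonym ('k, 'i) tvec = "'k \<Rightarrow> 'i \<Rightarrow> real"

definition tangent_space :: "('a, 'k, 'i) manifold \<Rightarrow> 'a \<Rightarrow> ('k, 'i) tvec set" where
  "tangent_space M p =
     {X. (\<forall>a i. a \<notin> charts_at M p \<or> i \<notin> coords M \<longrightarrow> X a i = 0) \<and>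
         (\<forall>a\<in>charts_at M p. \<forall>b\<in>charts_at M p. \<forall>j\<in>coords M.
            X b j = (\<Sum>i\<in>coords M.
              partial_deriv i (\<lambda>x. cmap M b (cinv M a x) j) (cmap M a p) * X a i))}"

abbreviation zero_tvec :: "('k, 'i) tvec" where
  "zero_tvec \<equiv> (\<lambda>_ _. 0)"

text \<open>
  Differentials of maps and of real functions at \<open>p\<close>, computed in some chart around \<open>p\<close>; by the
  chain rule the choice of the chart does not matter for tangent vectors and differentiable maps.
\<close>

definition tmap ::
    "('a, 'k, 'i) manifold \<Rightarrow> ('b, 'l, 'j) manifold \<Rightarrow> ('a \<Rightarrow> 'b) \<Rightarrow> 'a \<Rightarrow>
     ('k, 'i) tvec \<Rightarrow> ('l, 'j) tvec" where
  "tmap M N F p X = (\<lambda>b j.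
     if b \<in> charts_at N (F p) \<and> j \<in> coords N then
       let a = (SOME a. a \<in> charts_at M p) in
         \<Sum>i\<in>coords M. partial_deriv i (\<lambda>x. cmap N b (F (cinv M a x)) j) (cmap M a p) * X a i
     else 0)"

definition tdiff ::
    "('a, 'k, 'i) manifold \<Rightarrow> ('a \<Rightarrow> real) \<Rightarrow> 'a \<Rightarrow> ('k, 'i) tvec \<Rightarrow> real" where
  "tdiff M f p X =
     (let a = (SOME a. a \<in> charts_at M p) in
        \<Sum>i\<in>coords M. partial_deriv i (\<lambda>x. f (cinv M a x)) (cmap M a p) * X a i)"

definition vector_field :: "('a, 'k, 'i) manifold \<Rightarrow> ('a \<Rightarrow> ('k, 'i) tvec) \<Rightarrow> bool" where
  "vector_field M D \<longleftrightarrow>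
     (\<forall>p\<in>points M. D p \<in> tangent_space M p) \<and>
     (\<forall>a\<in>charts M. \<forall>i\<in>coords M.
        smooth_on (coords M) (cmap M a ` cdom M a) (\<lambda>x. D (cinv M a x) a i))"

subsection \<open>Finite products\<close>

text \<open>
  The product of the manifolds \<open>M v\<close>, \<open>v \<in> W\<close>, for finite \<open>W\<close>, with the atlas of product charts.
\<close>

definition prod_manifold ::
    "'v set \<Rightarrow> ('v \<Rightarrow> ('a, 'k, 'i) manifold) \<Rightarrow> ('v \<Rightarrow> 'a, 'v \<Rightarrow> 'k, 'v \<times> 'i) manifold" where
  "prod_manifold W M =
     \<lparr> mtop = product_topology (\<lambda>v. mtop (M v)) W,
       coords = (SIGMA v:W. coords (M v)),
       charts = (\<Pi>\<^sub>E v\<in>W. charts (M v)),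
       cdom = (\<lambda>c. \<Pi>\<^sub>E v\<in>W. cdom (M v) (c v)),
       cmap = (\<lambda>c q (v, i). if v \<in> W then cmap (M v) (c v) (q v) i else 0) \<rparr>"

text \<open>
  Tangent vectors of a product are written as families of tangent vectors of the factors; on
  arbitrary (also infinite) products this is the tangent space used below.  For finite \<open>W\<close>,
  \<open>of_family\<close> is the canonical isomorphism onto the tangent space of the product manifold.
\<close>

definition tangent_families ::
    "'v set \<Rightarrow> ('v \<Rightarrow> ('a, 'k, 'i) manifold) \<Rightarrow> ('v \<Rightarrow> 'a) \<Rightarrow> ('v \<Rightarrow> ('k, 'i) tvec) set" where
  "tangent_families W M q = (\<Pi>\<^sub>E v\<in>W. tangent_space (M v) (q v))"

definition of_family ::
    "'v set \<Rightarrow> ('v \<Rightarrow> ('a, 'k, 'i) manifold) \<Rightarrow> ('v \<Rightarrow> 'a) \<Rightarrow> ('v \<Rightarrow> ('k, 'i) tvec) \<Rightarrow>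
     ('v \<Rightarrow> 'k, 'v \<times> 'i) tvec" where
  "of_family W M q X =
     (\<lambda>c (v, i). if c \<in> charts_at (prod_manifold W M) q \<and> v \<in> W then X v (c v) i else 0)"

definition component :: "'v set \<Rightarrow> 'v \<Rightarrow> ('v \<Rightarrow> ('k, 'i) tvec) \<Rightarrow> 'v \<Rightarrow> ('k, 'i) tvec" where
  "component W v X = (\<lambda>v'\<in>W. if v' = v then X v else zero_tvec)"


section \<open>Lie groups\<close>

record ('g, 'l) lie = "'g monoid" +
  mfd :: "('g, 'l, nat) manifold"

definition lie_group :: "('g, 'l) lie \<Rightarrow> nat \<Rightarrow> bool" where
  "lie_group G d \<longleftrightarrow>
     group G \<and> smooth_manifold (mfd G) \<and> coords (mfd G) = {..<d} \<and> points (mfd G) = carrier G \<and>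
     smooth_map (prod_manifold (UNIV :: bool set) (\<lambda>_. mfd G)) (mfd G)
       (\<lambda>q. q False \<otimes>\<^bsub>G\<^esub> q True) \<and>
     smooth_map (mfd G) (mfd G) (\<lambda>g. inv\<^bsub>G\<^esub> g)"

text \<open>Only the vector space structure of the Lie algebra is used.\<close>

definition lie_alg :: "('g, 'l) lie \<Rightarrow> ('l, nat) tvec set" where
  "lie_alg G = tangent_space (mfd G) \<one>\<^bsub>G\<^esub>"

definition lie_alg_dual :: "('g, 'l) lie \<Rightarrow> (('l, nat) tvec \<Rightarrow> real) set" where
  "lie_alg_dual G =
     {f \<in> extensional (lie_alg G).
        \<forall>X\<in>lie_alg G. \<forall>Z\<in>lie_alg G. \<forall>r s.
          f (\<lambda>a i. r * X a i + s * Z a i) = r * f X + s * f Z}"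

definition maurer_cartan :: "('g, 'l) lie \<Rightarrow> 'g \<Rightarrow> ('l, nat) tvec \<Rightarrow> ('l, nat) tvec" where
  "maurer_cartan G g X = tmap (mfd G) (mfd G) (\<lambda>h. inv\<^bsub>G\<^esub> g \<otimes>\<^bsub>G\<^esub> h) g X"


section \<open>Abstract cellular complexes\<close>

text \<open>\<open>(a, b) \<in> incidence K\<close> means that the \<open>k\<close>-cell \<open>a\<close> and the \<open>(k+1)\<close>-cell \<open>b\<close> are incident.\<close>

record 'c cell_structure =
  cdim :: nat
  cells :: "nat \<Rightarrow> 'c set"
  incidence :: "('c \<times> 'c) set"

abbreviation vertices :: "'c cell_structure \<Rightarrow> 'c set" where
  "vertices K \<equiv> cells K 0"

abbreviation faces :: "'c cell_structure \<Rightarrow> 'c set" where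
  "faces K \<equiv> cells K (cdim K)"

definition adherent :: "'c cell_structure \<Rightarrow> 'c \<Rightarrow> 'c \<Rightarrow> bool" where
  "adherent K a b \<longleftrightarrow> (a, b) \<in> (incidence K)\<^sup>*"

definition face_verts :: "'c cell_structure \<Rightarrow> 'c \<Rightarrow> 'c set" where
  "face_verts K \<alpha> = {v \<in> vertices K. adherent K v \<alpha>}"

definition cell_complex :: "'c cell_structure \<Rightarrow> bool" where
  "cell_complex K \<longleftrightarrow>
     (\<forall>k l. k \<noteq> l \<longrightarrow> cells K k \<inter> cells K l = {}) \<and>
     (\<forall>k>cdim K. cells K k = {}) \<and>
     incidence K \<subseteq> (\<Union>k. cells K k \<times> cells K (Suc k)) \<and>
     (\<forall>\<alpha>\<in>faces K. finite (face_verts K \<alpha>))"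

definition star :: "'c cell_structure \<Rightarrow> 'c \<Rightarrow> 'c set" where
  "star K v = {\<alpha> \<in> faces K. adherent K v \<alpha>}"

definition star_verts :: "'c cell_structure \<Rightarrow> 'c \<Rightarrow> 'c set" where
  "star_verts K v = (\<Union>\<alpha>\<in>star K v. face_verts K \<alpha>)"

definition region_verts :: "'c cell_structure \<Rightarrow> 'c set \<Rightarrow> 'c set" where
  "region_verts K \<V> = {v \<in> vertices K. \<exists>\<alpha>\<in>\<V>. adherent K v \<alpha>}"

definition interior_verts :: "'c cell_structure \<Rightarrow> 'c set \<Rightarrow> 'c set" where
  "interior_verts K \<V> = {v \<in> region_verts K \<V>. star K v \<subseteq> \<V>}"

definition frontier_verts :: "'c cell_structure \<Rightarrow> 'c set \<Rightarrow> 'c set" where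
  "frontier_verts K \<V> = {v \<in> region_verts K \<V>. \<not> star K v \<subseteq> \<V>}"


section \<open>Sections and jets\<close>

text \<open>
  The bundle is given by the family \<open>Y\<close> of its fibers over the (discrete) set of vertices.
\<close>

type_synonym ('c, 'y, 'k) fiber_family = "'c \<Rightarrow> ('y, 'k, nat) manifold"
type_synonym ('c, 'y, 'k) fiber_field = "'c \<Rightarrow> 'y \<Rightarrow> ('k, nat) tvec"

definition sections :: "'c cell_structure \<Rightarrow> ('c, 'y, 'k) fiber_family \<Rightarrow> 'c set \<Rightarrow> ('c \<Rightarrow> 'y) set" where
  "sections K Y \<V> = (\<Pi>\<^sub>E v\<in>region_verts K \<V>. points (Y v))"

definition J1 :: "'c cell_structure \<Rightarrow> ('c, 'y, 'k) fiber_family \<Rightarrow> 'c \<Rightarrow>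
    ('c \<Rightarrow> 'y, 'c \<Rightarrow> 'k, 'c \<times> nat) manifold" where
  "J1 K Y \<alpha> = prod_manifold (face_verts K \<alpha>) Y"

text \<open>Used for sections as well as for their variations, both being families over vertices.\<close>

definition j1 :: "'c cell_structure \<Rightarrow> ('c \<Rightarrow> 'x) \<Rightarrow> 'c \<Rightarrow> 'c \<Rightarrow> 'x" where
  "j1 K y \<alpha> = restrict y (face_verts K \<alpha>)"

definition j2 :: "'c cell_structure \<Rightarrow> ('c \<Rightarrow> 'x) \<Rightarrow> 'c \<Rightarrow> 'c \<Rightarrow> 'x" where
  "j2 K y v = restrict y (star_verts K v)"

text \<open>
  The canonical projection \<open>\<pi>\<^sub>v\<^sub>\<alpha>\<close> for \<open>\<alpha>\<close> in the star of \<open>v\<close>, on points and, equally, on tangent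
  families.
\<close>

definition jproj :: "'c cell_structure \<Rightarrow> 'c \<Rightarrow> ('c \<Rightarrow> 'x) \<Rightarrow> 'c \<Rightarrow> 'x" where
  "jproj K \<alpha> q = restrict q (face_verts K \<alpha>)"

definition j1_field :: "'c cell_structure \<Rightarrow> ('c, 'y, 'k) fiber_field \<Rightarrow> 'c \<Rightarrow>
    ('c \<Rightarrow> 'y) \<Rightarrow> 'c \<Rightarrow> ('k, nat) tvec" where
  "j1_field K D \<alpha> q = (\<lambda>v\<in>face_verts K \<alpha>. D v (q v))"


section \<open>The Lagrange problem\<close>

type_synonym ('c, 'y) lagrangian = "'c \<Rightarrow> ('c \<Rightarrow> 'y) \<Rightarrow> real"
type_synonym ('c, 'y, 'g) constraint_map = "'c \<Rightarrow> ('c \<Rightarrow> 'y) \<Rightarrow> 'g"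

definition dL :: "'c cell_structure \<Rightarrow> ('c, 'y, 'k) fiber_family \<Rightarrow> ('c, 'y) lagrangian \<Rightarrow>
    'c \<Rightarrow> ('c \<Rightarrow> 'y) \<Rightarrow> ('c \<Rightarrow> ('k, nat) tvec) \<Rightarrow> real" where
  "dL K Y L \<alpha> q X = tdiff (J1 K Y \<alpha>) (L \<alpha>) q (of_family (face_verts K \<alpha>) Y q X)"

definition d\<Phi> :: "'c cell_structure \<Rightarrow> ('c, 'y, 'k) fiber_family \<Rightarrow> ('g, 'l) lie \<Rightarrow> ('c, 'y, 'g) constraint_map \<Rightarrow>
    'c \<Rightarrow> ('c \<Rightarrow> 'y) \<Rightarrow> ('c \<Rightarrow> ('k, nat) tvec) \<Rightarrow> ('l, nat) tvec" where
  "d\<Phi> K Y G \<Phi> \<alpha> q X =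
     tmap (J1 K Y \<alpha>) (mfd G) (\<Phi> \<alpha>) q (of_family (face_verts K \<alpha>) Y q X)"

definition \<theta>d\<Phi> :: "'c cell_structure \<Rightarrow> ('c, 'y, 'k) fiber_family \<Rightarrow> ('g, 'l) lie \<Rightarrow> ('c, 'y, 'g) constraint_map \<Rightarrow>
    'c \<Rightarrow> ('c \<Rightarrow> 'y) \<Rightarrow> ('c \<Rightarrow> ('k, nat) tvec) \<Rightarrow> ('l, nat) tvec" where
  "\<theta>d\<Phi> K Y G \<Phi> \<alpha> q X = maurer_cartan G (\<Phi> \<alpha> q) (d\<Phi> K Y G \<Phi> \<alpha> q X)"

definition lagrange_problem ::
    "'c cell_structure \<Rightarrow> nat \<Rightarrow> ('c, 'y, 'k) fiber_family \<Rightarrow> nat \<Rightarrow> ('g, 'l) lie \<Rightarrow>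
     ('c, 'y) lagrangian \<Rightarrow> ('c, 'y, 'g) constraint_map \<Rightarrow> bool" where
  "lagrange_problem K m Y d G L \<Phi> \<longleftrightarrow>
     cell_complex K \<and>
     (\<forall>v\<in>vertices K. smooth_manifold (Y v) \<and> coords (Y v) = {..<m}) \<and>
     lie_group G d \<and>
     (\<forall>\<alpha>\<in>faces K.
        smooth_function (J1 K Y \<alpha>) (L \<alpha>) \<and>
        differentiable_map (J1 K Y \<alpha>) (mfd G) (\<Phi> \<alpha>) \<and>
        (\<forall>q\<in>points (J1 K Y \<alpha>). \<Phi> \<alpha> q = \<one>\<^bsub>G\<^esub> \<longrightarrow>
           d\<Phi> K Y G \<Phi> \<alpha> q ` tangent_families (face_verts K \<alpha>) Y q = tangent_space (mfd G) \<one>\<^bsub>G\<^esub>))"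

definition constraint_set :: "'c cell_structure \<Rightarrow> ('c, 'y, 'k) fiber_family \<Rightarrow> ('g, 'l) lie \<Rightarrow>
    ('c, 'y, 'g) constraint_map \<Rightarrow> 'c \<Rightarrow> ('c \<Rightarrow> 'y) set" where
  "constraint_set K Y G \<Phi> \<alpha> = {q \<in> points (J1 K Y \<alpha>). \<Phi> \<alpha> q = \<one>\<^bsub>G\<^esub>}"

definition admissible_sections :: "'c cell_structure \<Rightarrow> ('c, 'y, 'k) fiber_family \<Rightarrow> ('g, 'l) lie \<Rightarrow>
    ('c, 'y, 'g) constraint_map \<Rightarrow> 'c set \<Rightarrow> ('c \<Rightarrow> 'y) set" where
  "admissible_sections K Y G \<Phi> \<V> =
     {y \<in> sections K Y \<V>. \<forall>\<alpha>\<in>\<V>. j1 K y \<alpha> \<in> constraint_set K Y G \<Phi> \<alpha>}"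

definition variations_fixed_boundary :: "'c cell_structure \<Rightarrow> ('c, 'y, 'k) fiber_family \<Rightarrow> 'c set \<Rightarrow>
    ('c \<Rightarrow> 'y) \<Rightarrow> ('c \<Rightarrow> ('k, nat) tvec) set" where
  "variations_fixed_boundary K Y \<V> y =
     {\<delta>y \<in> tangent_families (region_verts K \<V>) Y y. \<forall>v\<in>frontier_verts K \<V>. \<delta>y v = zero_tvec}"

definition admissible_variation :: "'c cell_structure \<Rightarrow> ('c, 'y, 'k) fiber_family \<Rightarrow> ('g, 'l) lie \<Rightarrow>
    ('c, 'y, 'g) constraint_map \<Rightarrow> 'c set \<Rightarrow> ('c \<Rightarrow> 'y) \<Rightarrow> ('c \<Rightarrow> ('k, nat) tvec) \<Rightarrow> bool" where
  "admissible_variation K Y G \<Phi> \<V> y \<delta>y \<longleftrightarrow>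
     \<delta>y \<in> tangent_families (region_verts K \<V>) Y y \<and>
     (\<forall>\<alpha>\<in>\<V>. d\<Phi> K Y G \<Phi> \<alpha> (j1 K y \<alpha>) (j1 K \<delta>y \<alpha>) = zero_tvec)"

definition action :: "'c cell_structure \<Rightarrow> ('c, 'y) lagrangian \<Rightarrow> 'c set \<Rightarrow> ('c \<Rightarrow> 'y) \<Rightarrow> real" where
  "action K L \<V> y = (\<Sum>\<alpha>\<in>\<V>. L \<alpha> (j1 K y \<alpha>))"

definition critical_section :: "'c cell_structure \<Rightarrow> ('c, 'y, 'k) fiber_family \<Rightarrow> ('g, 'l) lie \<Rightarrow>
    ('c, 'y) lagrangian \<Rightarrow> ('c, 'y, 'g) constraint_map \<Rightarrow> 'c set \<Rightarrow> ('c \<Rightarrow> 'y) \<Rightarrow> bool" where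
  "critical_section K Y G L \<Phi> \<V> y \<longleftrightarrow>
     y \<in> admissible_sections K Y G \<Phi> \<V> \<and>
     (\<forall>\<delta>y\<in>variations_fixed_boundary K Y \<V> y.
        admissible_variation K Y G \<Phi> \<V> y \<delta>y \<longrightarrow>
        tdiff (prod_manifold (region_verts K \<V>) Y) (action K L \<V>) y
          (of_family (region_verts K \<V>) Y y \<delta>y) = 0)"

definition regular_section :: "'c cell_structure \<Rightarrow> ('c, 'y, 'k) fiber_family \<Rightarrow> ('g, 'l) lie \<Rightarrow>
    ('c, 'y, 'g) constraint_map \<Rightarrow> 'c set \<Rightarrow> ('c \<Rightarrow> 'y) \<Rightarrow> bool" where
  "regular_section K Y G \<Phi> \<V> y \<longleftrightarrow>
     y \<in> admissible_sections K Y G \<Phi> \<V> \<and>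
     (\<lambda>\<delta>y. \<lambda>\<alpha>\<in>\<V>. \<theta>d\<Phi> K Y G \<Phi> \<alpha> (j1 K y \<alpha>) (j1 K \<delta>y \<alpha>)) ` variations_fixed_boundary K Y \<V> y
       = (\<V> \<rightarrow>\<^sub>E lie_alg G)"

subsection \<open>Cartan forms and the multiplier\<close>

definition cartan_L :: "'c cell_structure \<Rightarrow> ('c, 'y, 'k) fiber_family \<Rightarrow> ('c, 'y) lagrangian \<Rightarrow>
    'c \<Rightarrow> 'c \<Rightarrow> ('c \<Rightarrow> 'y) \<Rightarrow> ('c \<Rightarrow> ('k, nat) tvec) \<Rightarrow> real" where
  "cartan_L K Y L \<alpha> v q X = dL K Y L \<alpha> q (component (face_verts K \<alpha>) v X)"

definition cartan_\<Phi> :: "'c cell_structure \<Rightarrow> ('c, 'y, 'k) fiber_family \<Rightarrow> ('g, 'l) lie \<Rightarrow>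
    ('c, 'y, 'g) constraint_map \<Rightarrow>
    'c \<Rightarrow> 'c \<Rightarrow> ('c \<Rightarrow> 'y) \<Rightarrow> ('c \<Rightarrow> ('k, nat) tvec) \<Rightarrow> ('l, nat) tvec" where
  "cartan_\<Phi> K Y G \<Phi> \<alpha> v q X = \<theta>d\<Phi> K Y G \<Phi> \<alpha> q (component (face_verts K \<alpha>) v X)"

definition euler_form :: "'c cell_structure \<Rightarrow> ('c, 'y, 'k) fiber_family \<Rightarrow> ('c, 'y) lagrangian \<Rightarrow>
    'c \<Rightarrow> ('c \<Rightarrow> 'y) \<Rightarrow> ('c \<Rightarrow> ('k, nat) tvec) \<Rightarrow> real" where
  "euler_form K Y L v q X =
     (\<Sum>\<alpha>\<in>star K v. cartan_L K Y L \<alpha> v (jproj K \<alpha> q) (jproj K \<alpha> X))"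

text \<open>
  For a regular critical section there is exactly one such \<open>\<mu>\<close>, so this property determines
  the multiplier.
\<close>

definition multiplier :: "'c cell_structure \<Rightarrow> ('c, 'y, 'k) fiber_family \<Rightarrow> ('g, 'l) lie \<Rightarrow>
    ('c, 'y) lagrangian \<Rightarrow> ('c, 'y, 'g) constraint_map \<Rightarrow> 'c set \<Rightarrow> ('c \<Rightarrow> 'y) \<Rightarrow>
    ('c \<Rightarrow> ('l, nat) tvec \<Rightarrow> real) \<Rightarrow> bool" where
  "multiplier K Y G L \<Phi> \<V> y \<mu> \<longleftrightarrow>
     \<mu> \<in> (\<V> \<rightarrow>\<^sub>E lie_alg_dual G) \<and>
     (\<forall>v\<in>interior_verts K \<V>. \<forall>X\<in>tangent_families (star_verts K v) Y (j2 K y v).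
        euler_form K Y L v (j2 K y v) X +
        (\<Sum>\<alpha>\<in>star K v.
           \<mu> \<alpha> (cartan_\<Phi> K Y G \<Phi> \<alpha> v (jproj K \<alpha> (j2 K y v)) (jproj K \<alpha> X))) = 0)"

subsection \<open>Symmetries\<close>

definition bundle_field :: "'c cell_structure \<Rightarrow> ('c, 'y, 'k) fiber_family \<Rightarrow> ('c, 'y, 'k) fiber_field \<Rightarrow> bool" where
  "bundle_field K Y D \<longleftrightarrow> (\<forall>v\<in>vertices K. vector_field (Y v) (D v))"

definition infinitesimal_symmetry :: "'c cell_structure \<Rightarrow> ('c, 'y, 'k) fiber_family \<Rightarrow> ('g, 'l) lie \<Rightarrow>
    ('c, 'y) lagrangian \<Rightarrow> ('c, 'y, 'g) constraint_map \<Rightarrow> ('c, 'y, 'k) fiber_field \<Rightarrow> bool" where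
  "infinitesimal_symmetry K Y G L \<Phi> D \<longleftrightarrow>
     bundle_field K Y D \<and>
     (\<forall>\<alpha>\<in>faces K. \<forall>q\<in>points (J1 K Y \<alpha>).
        dL K Y L \<alpha> q (j1_field K D \<alpha> q) = 0 \<and>
        d\<Phi> K Y G \<Phi> \<alpha> q (j1_field K D \<alpha> q) = zero_tvec)"

end

theory Submission
  imports Defs
begin

text \<open>
  For each face, linearity of the differentials and the symmetry conditions make the sum of
  \<open>(\<Theta>(L) + \<lambda> \<circ> \<Theta>(\<Phi>))(j\<^sup>1D)\<close> over all vertices of the face vanish.  Summing over the faces of the
  region and exchanging the sums, the multiplier equation evaluated on \<open>j\<^sup>2D\<close> removes the interior
  vertices, whose stars lie in the region; what remains is the frontier sum.
  Pairing with \<open>\<lambda>\<close> needs the values of \<open>\<Theta>(\<Phi>)\<close> to lie in the Lie algebra: at points of the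
  constraint set \<open>\<theta>\<close> is the identity and \<open>d\<Phi>\<close> has values in the tangent space at the neutral element.
\<close>

section \<open>Locality of partial derivatives and the differential of a local identity\<close>

lemma eventually_fun_upd_in_open:
  assumes U: "openin (coord_space I) U" and x: "x \<in> U" and i: "i \<in> I"
  shows "eventually (\<lambda>t. x(i := t) \<in> U) (nhds (x i))"
proof -
  \<comment> \<open>Needed for the coordinate line through \<open>x\<close> to stay in
    \<open>coord_space I\<close>, where entries off \<open>I\<close> are 0.\<close>
  have x0: "\<forall>j. j \<notin> I \<longrightarrow> x j = 0"
    using openin_subset[OF U] x by (auto simp: coord_space_def)
  have "continuous_map euclideanreal (coord_space I) (\<lambda>t. x(i := t))"
    unfolding coord_space_def
  proof (rule continuous_map_into_subtopology)
    have "continuous_map euclideanreal euclideanreal (\<lambda>t. (x(i := t)) k)" for k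
      by (cases "k = i") auto
    then show "continuous_map euclideanreal (powertop_real UNIV) (\<lambda>t. x(i := t))"
      by (simp add: continuous_map_componentwise_UNIV)
  qed (use x0 i in auto)
  then have "openin euclideanreal {t \<in> topspace euclideanreal. x(i := t) \<in> U}"
    using U by (rule openin_continuous_map_preimage)
  then have "open {t. x(i := t) \<in> U}" by simp
  then show ?thesis
    using x by (auto simp: eventually_nhds)
qed

text \<open>Derivatives along a coordinate line see only values near \<open>x\<close>, so values
  outside a chart image, where \<open>cinv\<close> is arbitrary, do not matter.\<close>

lemma partial_deriv_cong_open:
  assumes "openin (coord_space I) U" "x \<in> U" "i \<in> I" and "\<And>z. z \<in> U \<Longrightarrow> f z = g z"
  shows "partial_deriv i f x = partial_deriv i g x"
  unfolding partial_deriv_def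
  by (rule deriv_cong_ev)
    (use eventually_fun_upd_in_open[OF assms(1-3)] assms(4) in \<open>auto elim: eventually_mono\<close>)

text \<open>In a chart \<open>F\<close> drops out, and the formula of \<open>tmap\<close> becomes
  the Jacobian rule that relates the entries of a tangent vector in different charts.\<close>

lemma tmap_locally_id:
  assumes M: "smooth_manifold M" and p: "p \<in> points M"
    and F: "\<And>q. q \<in> points M \<Longrightarrow> F q = q" and X: "X \<in> tangent_space M p"
  shows "tmap M M F p X = X"
proof -
  \<comment> \<open>The very chart that the definition of \<open>tmap\<close> selects at
    \<open>p\<close>.\<close>
  define a where "a = (SOME a. a \<in> charts_at M p)"
  have "\<exists>a. a \<in> charts_at M p"
    using M p by (auto simp: smooth_manifold_def charts_at_def)
  then have a: "a \<in> charts_at M p" unfolding a_def by (rule someI_ex)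
  have U: "openin (coord_space (coords M)) (cmap M a ` cdom M a)"
    and dom: "cdom M a \<subseteq> points M"
    using M a by (auto simp: smooth_manifold_def charts_at_def dest: openin_subset)
  have pU: "cmap M a p \<in> cmap M a ` cdom M a"
    using a by (auto simp: charts_at_def)
  have eq: "F (cinv M a z) = cinv M a z" if "z \<in> cmap M a ` cdom M a" for z
    using inv_into_into[OF that] dom by (intro F) (auto simp: cinv_def)
  have "partial_deriv i (\<lambda>x. cmap M b (F (cinv M a x)) j) (cmap M a p)
      = partial_deriv i (\<lambda>x. cmap M b (cinv M a x) j) (cmap M a p)" if "i \<in> coords M" for i b j
    by (rule partial_deriv_cong_open[OF U pU that]) (simp add: eq)
  then show ?thesis
    using X a F[OF p] by (intro ext) (auto simp: tmap_def tangent_space_def Let_def simp flip: a_def)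
qed

section \<open>Linear combinations in tangent spaces and in the dual Lie algebra\<close>

lemma zero_in_tangent_space [simp]: "zero_tvec \<in> tangent_space M p"
  by (simp add: tangent_space_def)

lemma sum_in_tangent_space:
  assumes "\<And>v. v \<in> W \<Longrightarrow> X v \<in> tangent_space M p"
  shows "(\<lambda>a i. \<Sum>v\<in>W. X v a i) \<in> tangent_space M p"
proof -
  have "(\<Sum>v\<in>W. X v b j) = (\<Sum>i\<in>coords M.
      partial_deriv i (\<lambda>x. cmap M b (cinv M a x) j) (cmap M a p) * (\<Sum>v\<in>W. X v a i))"
    if "a \<in> charts_at M p" "b \<in> charts_at M p" "j \<in> coords M" for a b j
  proof -
    have "(\<Sum>v\<in>W. X v b j) = (\<Sum>v\<in>W. \<Sum>i\<in>coords M.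
        partial_deriv i (\<lambda>x. cmap M b (cinv M a x) j) (cmap M a p) * X v a i)"
      using assms that unfolding tangent_space_def by (intro sum.cong refl) blast
    then show ?thesis by (simp add: sum_distrib_left sum.swap[of _ W])
  qed
  moreover have "(\<Sum>v\<in>W. X v a i) = 0" if "a \<notin> charts_at M p \<or> i \<notin> coords M" for a i
    using assms that unfolding tangent_space_def by (intro sum.neutral) blast
  ultimately show ?thesis
    unfolding tangent_space_def by blast
qed

lemma lie_alg_dual_linear:
  assumes "f \<in> lie_alg_dual G" "X \<in> lie_alg G" "Z \<in> lie_alg G"
  shows "f (\<lambda>a i. r * X a i + s * Z a i) = r * f X + s * f Z"
  using assms by (simp add: lie_alg_dual_def)

lemma lie_alg_dual_sum:
  assumes f: "f \<in> lie_alg_dual G" and "finite W" and "\<And>v. v \<in> W \<Longrightarrow> X v \<in> lie_alg G"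
  shows "f (\<lambda>a i. \<Sum>v\<in>W. X v a i) = (\<Sum>v\<in>W. f (X v))"
  using assms(2,3)
proof (induction W rule: finite_induct)
  case empty
  \<comment> \<open>Membership in the dual speaks of two-term combinations only; coefficients 0
    extract the value at the zero vector.\<close>
  have "f (\<lambda>a i. 0 * zero_tvec a i + 0 * zero_tvec a i) = 0 * f zero_tvec + 0 * f zero_tvec"
    by (rule lie_alg_dual_linear[OF f]) (simp_all add: lie_alg_def)
  then show ?case by simp
next
  case (insert w W)
  have "(\<lambda>a i. \<Sum>v\<in>W. X v a i) \<in> lie_alg G"
    using insert.prems unfolding lie_alg_def by (intro sum_in_tangent_space) auto
  then have "f (\<lambda>a i. 1 * X w a i + 1 * (\<Sum>v\<in>W. X v a i)) = 1 * f (X w) + 1 * f (\<lambda>a i. \<Sum>v\<in>W. X v a i)"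
    using insert.prems by (intro lie_alg_dual_linear[OF f]) auto
  then show ?case using insert by simp
qed

lemma of_family_sum_components:
  assumes "finite W"
  shows "of_family W M q X c k = (\<Sum>v\<in>W. of_family W M q (component W v X) c k)"
proof (cases k)
  case (Pair w i)
  have "(\<Sum>v\<in>W. of_family W M q (component W v X) c (w, i))
      = (\<Sum>v\<in>W. if v = w then of_family W M q X c (w, i) else 0)"
    by (intro sum.cong) (auto simp: of_family_def component_def)
  also have "\<dots> = of_family W M q X c (w, i)"
    using assms by (auto simp: of_family_def)
  finally show ?thesis by (simp add: Pair)
qed

text \<open>The chart in \<open>tdiff\<close> depends on the point alone, so all summands share it,
  and the formula there is linear in the coordinate vector.\<close>

lemma tdiff_sum:
  assumes "\<And>a i. X a i = (\<Sum>v\<in>W. Z v a i)"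
  shows "tdiff M f p X = (\<Sum>v\<in>W. tdiff M f p (Z v))"
  unfolding tdiff_def Let_def assms sum_distrib_left by (rule sum.swap)

lemma tmap_sum:
  assumes "\<And>a i. X a i = (\<Sum>v\<in>W. Z v a i)"
  shows "tmap M N F p X = (\<lambda>b j. \<Sum>v\<in>W. tmap M N F p (Z v) b j)"
  by (intro ext) (auto simp: tmap_def Let_def assms sum_distrib_left sum.swap[of _ W] intro!: sum.neutral[symmetric])

section \<open>Cartan forms as components of the differentials\<close>

lemma dL_sum_cartan:
  assumes "finite (face_verts K \<alpha>)"
  shows "dL K Y L \<alpha> q X = (\<Sum>v\<in>face_verts K \<alpha>. cartan_L K Y L \<alpha> v q X)"
  unfolding cartan_L_def dL_def
  by (rule tdiff_sum) (rule of_family_sum_components[OF assms])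

lemma d\<Phi>_sum_components:
  assumes "finite (face_verts K \<alpha>)"
  shows "d\<Phi> K Y G \<Phi> \<alpha> q X
    = (\<lambda>b j. \<Sum>v\<in>face_verts K \<alpha>. d\<Phi> K Y G \<Phi> \<alpha> q (component (face_verts K \<alpha>) v X) b j)"
  unfolding d\<Phi>_def
  by (rule tmap_sum) (rule of_family_sum_components[OF assms])

lemma component_in_tangent_families:
  "X \<in> tangent_families W M q \<Longrightarrow> component W v X \<in> tangent_families W M q"
  by (auto simp: tangent_families_def component_def PiE_iff)

text \<open>Left translation by the inverse of the neutral element is the identity on the carrier,
  which is the point set of \<open>mfd G\<close>.\<close>

lemma maurer_cartan_one:
  assumes G: "lie_group G d" and X: "X \<in> lie_alg G"
  shows "maurer_cartan G \<one>\<^bsub>G\<^esub> X = X"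
proof -
  interpret group G using G by (simp add: lie_group_def)
  show ?thesis
    unfolding maurer_cartan_def
    by (rule tmap_locally_id) (use G X in \<open>auto simp: lie_group_def lie_alg_def\<close>)
qed

text \<open>The regular value condition equates the image of \<open>d\<Phi>\<close> with the tangent
  space at the neutral element, so tangency of the values is read off from it instead of from a
  chain rule.\<close>

lemma d\<Phi>_in_lie_alg:
  assumes "lagrange_problem K m Y d G L \<Phi>" and "\<alpha> \<in> faces K"
    and "q \<in> constraint_set K Y G \<Phi> \<alpha>" and "X \<in> tangent_families (face_verts K \<alpha>) Y q"
  shows "d\<Phi> K Y G \<Phi> \<alpha> q X \<in> lie_alg G"
  using assms unfolding lagrange_problem_def constraint_set_def lie_alg_def by blast

lemma \<theta>d\<Phi>_eq_d\<Phi>: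
  assumes "lagrange_problem K m Y d G L \<Phi>" and "\<alpha> \<in> faces K"
    and "q \<in> constraint_set K Y G \<Phi> \<alpha>" and "X \<in> tangent_families (face_verts K \<alpha>) Y q"
  shows "\<theta>d\<Phi> K Y G \<Phi> \<alpha> q X = d\<Phi> K Y G \<Phi> \<alpha> q X"
proof -
  have "\<Phi> \<alpha> q = \<one>\<^bsub>G\<^esub>" using assms(3) by (simp add: constraint_set_def)
  moreover have "lie_group G d" using assms(1) by (simp add: lagrange_problem_def)
  ultimately show ?thesis
    using maurer_cartan_one d\<Phi>_in_lie_alg[OF assms] by (simp add: \<theta>d\<Phi>_def)
qed

text \<open>Additivity of \<open>f\<close> is available only on \<open>lie_alg G\<close>. The
  components of \<open>X\<close> are again tangent families, so at a constraint point each summand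
  lies there.\<close>

lemma dual_cartan_\<Phi>_sum:
  assumes P: "lagrange_problem K m Y d G L \<Phi>" and \<alpha>: "\<alpha> \<in> faces K"
    and q: "q \<in> constraint_set K Y G \<Phi> \<alpha>" and X: "X \<in> tangent_families (face_verts K \<alpha>) Y q"
    and f: "f \<in> lie_alg_dual G"
  shows "f (d\<Phi> K Y G \<Phi> \<alpha> q X) = (\<Sum>v\<in>face_verts K \<alpha>. f (cartan_\<Phi> K Y G \<Phi> \<alpha> v q X))"
proof -
  have fin: "finite (face_verts K \<alpha>)"
    using P \<alpha> by (simp add: lagrange_problem_def cell_complex_def)
  note C = component_in_tangent_families[OF X]
  show ?thesis
    by (subst d\<Phi>_sum_components[OF fin], subst lie_alg_dual_sum[OF f fin])
      (simp_all add: cartan_\<Phi>_def \<theta>d\<Phi>_eq_d\<Phi>[OF P \<alpha> q C] d\<Phi>_in_lie_alg[OF P \<alpha> q C])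
qed

section \<open>The vanishing sums over a face and over an interior star\<close>

lemma face_sum_symmetry_zero:
  assumes P: "lagrange_problem K m Y d G L \<Phi>" and \<alpha>: "\<alpha> \<in> faces K"
    and q: "q \<in> constraint_set K Y G \<Phi> \<alpha>" and f: "f \<in> lie_alg_dual G"
    and D: "infinitesimal_symmetry K Y G L \<Phi> D"
  shows "(\<Sum>v\<in>face_verts K \<alpha>. cartan_L K Y L \<alpha> v q (j1_field K D \<alpha> q)
      + f (cartan_\<Phi> K Y G \<Phi> \<alpha> v q (j1_field K D \<alpha> q))) = 0"
proof -
  have fin: "finite (face_verts K \<alpha>)"
    using P \<alpha> by (simp add: lagrange_problem_def cell_complex_def)
  have q': "q \<in> points (J1 K Y \<alpha>)" using q by (simp add: constraint_set_def)
  have X: "j1_field K D \<alpha> q \<in> tangent_families (face_verts K \<alpha>) Y q"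
    using D q' by (auto simp: infinitesimal_symmetry_def bundle_field_def vector_field_def
        J1_def prod_manifold_def tangent_families_def j1_field_def face_verts_def PiE_iff)
  have "dL K Y L \<alpha> q (j1_field K D \<alpha> q) = 0" "d\<Phi> K Y G \<Phi> \<alpha> q (j1_field K D \<alpha> q) = zero_tvec"
    using D \<alpha> q' by (auto simp: infinitesimal_symmetry_def)
  \<comment> \<open>The empty sum gives the zero vector.\<close>
  moreover have "f zero_tvec = 0"
    using lie_alg_dual_sum[OF f, of "{}"] by simp
  ultimately show ?thesis
    using dL_sum_cartan[OF fin, of Y L q "j1_field K D \<alpha> q"] dual_cartan_\<Phi>_sum[OF P \<alpha> q X f]
    by (simp add: sum.distrib)
qed

lemma star_sum_multiplier_zero:
  assumes \<mu>: "multiplier K Y G L \<Phi> \<V> y \<mu>" and D: "bundle_field K Y D"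
    and y: "y \<in> sections K Y \<V>" and v: "v \<in> interior_verts K \<V>"
  shows "(\<Sum>\<alpha>\<in>star K v. cartan_L K Y L \<alpha> v (j1 K y \<alpha>) (j1_field K D \<alpha> (j1 K y \<alpha>))
      + \<mu> \<alpha> (cartan_\<Phi> K Y G \<Phi> \<alpha> v (j1 K y \<alpha>) (j1_field K D \<alpha> (j1 K y \<alpha>)))) = 0"
proof -
  \<comment> \<open>The second jet of \<open>D\<close> along \<open>y\<close>, the test vector for
    the multiplier equation.\<close>
  define X where "X = (\<lambda>w\<in>star_verts K v. D w (y w))"
  \<comment> \<open>Here interiority enters: \<open>y\<close> takes values in the fibers only over
    \<open>region_verts K \<V>\<close>, and \<open>X\<close> evaluates it on the whole star.\<close>
  have "star_verts K v \<subseteq> region_verts K \<V>"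
    using v by (auto simp: interior_verts_def star_verts_def region_verts_def face_verts_def)
  then have X: "X \<in> tangent_families (star_verts K v) Y (j2 K y v)"
    using D y by (auto simp: X_def tangent_families_def j2_def bundle_field_def vector_field_def
        sections_def region_verts_def PiE_iff subset_iff)
  have sub: "face_verts K \<alpha> \<subseteq> star_verts K v" if "\<alpha> \<in> star K v" for \<alpha>
    using that by (auto simp: star_verts_def)
  have "jproj K \<alpha> (j2 K y v) = j1 K y \<alpha>" "jproj K \<alpha> X = j1_field K D \<alpha> (j1 K y \<alpha>)"
    if "\<alpha> \<in> star K v" for \<alpha>
    using sub[OF that] by (auto simp: jproj_def j2_def j1_def j1_field_def X_def fun_eq_iff)
  moreover have "euler_form K Y L v (j2 K y v) X + (\<Sum>\<alpha>\<in>star K v.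
      \<mu> \<alpha> (cartan_\<Phi> K Y G \<Phi> \<alpha> v (jproj K \<alpha> (j2 K y v)) (jproj K \<alpha> X))) = 0"
    using \<mu> v X by (auto simp: multiplier_def)
  ultimately show ?thesis
    by (simp add: euler_form_def sum.distrib)
qed

theorem theorem3p7:
  fixes K :: "'c cell_structure" and m d :: nat
    and Y :: "('c, 'y, 'k) fiber_family" and G :: "('g, 'l) lie"
    and L :: "('c, 'y) lagrangian" and \<Phi> :: "('c, 'y, 'g) constraint_map"
    and \<V> :: "'c set" and y :: "'c \<Rightarrow> 'y"
    and \<mu> :: "'c \<Rightarrow> ('l, nat) tvec \<Rightarrow> real" and D :: "('c, 'y, 'k) fiber_field"
  assumes "lagrange_problem K m Y d G L \<Phi>"
    and "finite \<V>" and "\<V> \<subseteq> faces K"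
    and "regular_section K Y G \<Phi> \<V> y"
    and "critical_section K Y G L \<Phi> \<V> y"
    and "multiplier K Y G L \<Phi> \<V> y \<mu>"
    and "infinitesimal_symmetry K Y G L \<Phi> D"
  shows "(\<Sum>(v, \<alpha>)\<in>{(v, \<alpha>). v \<in> frontier_verts K \<V> \<and> \<alpha> \<in> \<V> \<and> adherent K v \<alpha>}.
            cartan_L K Y L \<alpha> v (j1 K y \<alpha>) (j1_field K D \<alpha> (j1 K y \<alpha>)) +
            \<mu> \<alpha> (cartan_\<Phi> K Y G \<Phi> \<alpha> v (j1 K y \<alpha>) (j1_field K D \<alpha> (j1 K y \<alpha>)))) = 0"
proof -
  define g where "g v \<alpha> = cartan_L K Y L \<alpha> v (j1 K y \<alpha>) (j1_field K D \<alpha> (j1 K y \<alpha>)) +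
    \<mu> \<alpha> (cartan_\<Phi> K Y G \<Phi> \<alpha> v (j1 K y \<alpha>) (j1_field K D \<alpha> (j1 K y \<alpha>)))" for v \<alpha>
  have y: "y \<in> sections K Y \<V>" and adm: "\<And>\<alpha>. \<alpha> \<in> \<V> \<Longrightarrow> j1 K y \<alpha> \<in> constraint_set K Y G \<Phi> \<alpha>"
    using assms(4) by (auto simp: regular_section_def admissible_sections_def)
  have fin: "finite (face_verts K \<alpha>)" if "\<alpha> \<in> \<V>" for \<alpha>
    using assms(1,3) that by (auto simp: lagrange_problem_def cell_complex_def)
  have face: "(\<Sum>v\<in>face_verts K \<alpha>. g v \<alpha>) = 0" if "\<alpha> \<in> \<V>" for \<alpha>
  proof -
    have "\<mu> \<alpha> \<in> lie_alg_dual G" using assms(6) that by (auto simp: multiplier_def)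
    then show ?thesis
      using face_sum_symmetry_zero[OF assms(1) _ adm[OF that] _ assms(7)] assms(3) that
      by (auto simp: g_def)
  qed
  have region: "region_verts K \<V> = (\<Union>\<alpha>\<in>\<V>. face_verts K \<alpha>)"
    by (auto simp: region_verts_def face_verts_def)
  have finR: "finite (region_verts K \<V>)"
    using fin assms(2) by (simp add: region)
  \<comment> \<open>So at interior vertices the star sums of \<open>multiplier\<close> are finite
    and coincide with the inner sums of the double count below.\<close>
  have star: "star K v = {\<alpha> \<in> \<V>. adherent K v \<alpha>}" if "v \<in> interior_verts K \<V>" for v
    using that assms(3) by (auto simp: interior_verts_def star_def)
  \<comment> \<open>All incident pairs of a vertex and a face of the region, counted by vertices and
    then by faces.\<close>
  have "(\<Sum>v\<in>region_verts K \<V>. \<Sum>\<alpha>\<in>{\<alpha> \<in> \<V>. adherent K v \<alpha>}. g v \<alpha>)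
      = (\<Sum>\<alpha>\<in>\<V>. \<Sum>v\<in>{v \<in> region_verts K \<V>. adherent K v \<alpha>}. g v \<alpha>)"
    by (rule sum.swap_restrict[OF finR assms(2)])
  also have "\<dots> = (\<Sum>\<alpha>\<in>\<V>. \<Sum>v\<in>face_verts K \<alpha>. g v \<alpha>)"
    by (intro sum.cong refl) (auto simp: region_verts_def face_verts_def)
  also have "\<dots> = 0" by (simp add: face)
  finally have total: "(\<Sum>v\<in>region_verts K \<V>. \<Sum>\<alpha>\<in>{\<alpha> \<in> \<V>. adherent K v \<alpha>}. g v \<alpha>) = 0" .
  have int: "(\<Sum>\<alpha>\<in>{\<alpha> \<in> \<V>. adherent K v \<alpha>}. g v \<alpha>) = 0" if "v \<in> interior_verts K \<V>" for v
    using star_sum_multiplier_zero[OF assms(6) _ y that, of D] assms(7)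
    by (simp add: star[OF that] g_def infinitesimal_symmetry_def)
  \<comment> \<open>The right-hand 0 is replaced by the sum over all region vertices; those off the
    frontier are interior and contribute 0 by \<open>int\<close>.\<close>
  have "(\<Sum>v\<in>frontier_verts K \<V>. \<Sum>\<alpha>\<in>{\<alpha> \<in> \<V>. adherent K v \<alpha>}. g v \<alpha>) = 0"
    unfolding total[symmetric]
    by (rule sum.mono_neutral_left[OF finR])
      (auto simp: frontier_verts_def interior_verts_def intro!: int)
  moreover have "finite (frontier_verts K \<V>)"
    using finR by (rule finite_subset[rotated]) (auto simp: frontier_verts_def)
  moreover have "{(v, \<alpha>). v \<in> frontier_verts K \<V> \<and> \<alpha> \<in> \<V> \<and> adherent K v \<alpha>}
      = (SIGMA v:frontier_verts K \<V>. {\<alpha> \<in> \<V>. adherent K v \<alpha>})"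
    by auto
  ultimately show ?thesis
    using assms(2) by (simp add: sum.Sigma g_def)
qed

end
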